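(* Let $X=(X_1,\ldots,X_N)$ be a family of independent random variables with $X_k\in\{0,1\}$ and $p_k=\mathbb{P}(X_k=1)$. Let $\Gamma\subseteq\{0,1\}^N$ be an event and let $f:\{0,1\}^N\to\mathbb{R}$ be a function. Assume that there are numbers $(c_k)_{k\in[N]}$ and $(d_k)_{k\in[N]}$ with $c_k\le d_k$ such that whenever $x,\tilde x\in\{0,1\}^N$ differ only in the $k$-th coordinate we have $|f(x)-f(\tilde x)|\le c_k$ if $x\in\Gamma$, and $|f(x)-f(\tilde x)|\le d_k$ otherwise. Then for any numbers $(\gamma_k)_{k\in[N]}$ with $\gamma_k\in(0,1]$ there is an event $\mathcal{B}=\mathcal{B}(\Gamma,(\gamma_k)_{k\in[N]})$ satisfying $$\mathbb{P}(\mathcal{B})\le\sum_{k\in[N]}\gamma_k^{-1}\cdot\mathbb{P}(X\notin\Gamma)\quad\text{and}\quad\neg\mathcal{B}\subseteq\Gamma,$$ such that for $\mu=\mathbb{E}f(X)$ and any $t\ge0$ we have $$\mathbb{P}(f(X)\ge\mu+t\text{ and }\neg\mathcal{B})\le\exp\left(-\frac{t^2}{2\sum_{k\in[N]}(1-p_k)p_k(c_k+e_k)^2+2Ct/3}\right),$$ where $e_k=\gamma_k(d_k-c_k)$ and $C=\max_{k\in[N]}(c_k+e_k)$.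
   Context: $[N]=\{1,\ldots,N\}$. Events $\mathcal{B},\Gamma$ are identified with subsets of $\{0,1\}^N$; $\mathbb{P}(\mathcal{B})=\mathbb{P}(X\in\mathcal{B})$ and $\neg\mathcal{B}$ is the complement. The notation $\mathcal{B}=\mathcal{B}(\Gamma,(\gamma_k)_{k\in[N]})$ means that $\mathcal{B}$ depends only on $\Gamma$ and $(\gamma_k)$ (and the law of $X$), not on $f$ or $t$. *)

theory Defs
  imports "HOL-Probability.Probability"
begin

text \<open>Elements of \<open>{0,1}\<^sup>N\<close> are extensional functions on \<open>{1..N}\<close>.\<close>

definition cube :: "nat \<Rightarrow> (nat \<Rightarrow> nat) set" where
  "cube N = {1..N} \<rightarrow>\<^sub>E {0, 1}"

definition differ_only_at :: "nat \<Rightarrow> nat \<Rightarrow> (nat \<Rightarrow> nat) \<Rightarrow> (nat \<Rightarrow> nat) \<Rightarrow> bool" where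
  "differ_only_at N k x y \<longleftrightarrow> x k \<noteq> y k \<and> (\<forall>j\<in>{1..N}. j \<noteq> k \<longrightarrow> x j = y j)"

text \<open>The bound \<open>c k\<close> is required as soon as the first argument \<open>x\<close> is in \<open>\<Gamma>\<close>;
  nothing is asked of \<open>y\<close>.\<close>

definition typical_lipschitz ::
  "nat \<Rightarrow> (nat \<Rightarrow> nat) set \<Rightarrow> ((nat \<Rightarrow> nat) \<Rightarrow> real) \<Rightarrow> (nat \<Rightarrow> real) \<Rightarrow> (nat \<Rightarrow> real) \<Rightarrow> bool" where
  "typical_lipschitz N \<Gamma> f c d \<longleftrightarrow>
     (\<forall>k\<in>{1..N}. \<forall>x\<in>cube N. \<forall>y\<in>cube N. differ_only_at N k x y \<longrightarrow>
        \<bar>f x - f y\<bar> \<le> (if x \<in> \<Gamma> then c k else d k))"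

definition independent_bits ::
  "'a measure \<Rightarrow> nat \<Rightarrow> (nat \<Rightarrow> 'a \<Rightarrow> nat) \<Rightarrow> (nat \<Rightarrow> real) \<Rightarrow> bool" where
  "independent_bits M N X p \<longleftrightarrow>
     prob_space M \<and>
     prob_space.indep_vars M (\<lambda>_. count_space UNIV) X {1..N} \<and>
     (\<forall>k\<in>{1..N}. \<forall>\<omega>\<in>space M. X k \<omega> \<in> {0, 1}) \<and>
     (\<forall>k\<in>{1..N}. p k = \<P>(\<omega> in M. X k \<omega> = 1))"

definition joint :: "nat \<Rightarrow> (nat \<Rightarrow> 'a \<Rightarrow> nat) \<Rightarrow> 'a \<Rightarrow> (nat \<Rightarrow> nat)" where
  "joint N X \<omega> = (\<lambda>k\<in>{1..N}. X k \<omega>)"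

end

theory Submission
  imports Defs
begin

text \<open>
  Averaging out the coordinates \<open>k, \<dots>, N\<close> of a function on the cube gives its conditional expectation
  given \<open>X\<^sub>1, \<dots>, X\<^sub>k\<^sub>-\<^sub>1\<close>. Let \<open>q\<^sub>k\<close> be the conditional probability of \<open>X \<notin> \<Gamma>\<close> obtained this way,
  and let the bad event consist of the points outside \<open>\<Gamma>\<close> and those with \<open>q\<^sub>k > \<gamma>\<^sub>k\<close> for some \<open>k\<close>;
  its probability is controlled by Markov's inequality. Flipping coordinate \<open>k\<close> changes \<open>f\<close> by
  more than \<open>c\<^sub>k\<close> only if both endpoints lie outside \<open>\<Gamma>\<close>, so the \<open>k\<close>-th increment of the Doob
  martingale of \<open>f\<close> has range at most \<open>c\<^sub>k + q\<^sub>k (d\<^sub>k - c\<^sub>k)\<close>. Since \<open>q\<^sub>k\<close> depends only on the first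
  \<open>k - 1\<close> coordinates, the martingale may be stopped as soon as \<open>q\<^sub>k > \<gamma>\<^sub>k\<close>, and the usual
  Bernstein bound on exponential moments applies to the stopped martingale.
\<close>

section \<open>Averaging over coordinates\<close>

text \<open>Coordinate \<open>k\<close> is resampled with explicit weights and no measure, so
  conditional expectations are total functions and their laws follow by induction on lists.\<close>

definition avg :: "(nat \<Rightarrow> real) \<Rightarrow> nat \<Rightarrow> ((nat \<Rightarrow> nat) \<Rightarrow> real) \<Rightarrow> (nat \<Rightarrow> nat) \<Rightarrow> real" where
  "avg p k h x = (1 - p k) * h (x(k := 0)) + p k * h (x(k := 1))"

text \<open>The head of the list is averaged last, so peeling it off \<open>[k..<Suc N]\<close> is
  one step of the Doob martingale.\<close>

definition avgs :: "(nat \<Rightarrow> real) \<Rightarrow> nat list \<Rightarrow> ((nat \<Rightarrow> nat) \<Rightarrow> real) \<Rightarrow> (nat \<Rightarrow> nat) \<Rightarrow> real" where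
  "avgs p ks h = foldr (avg p) ks h"

definition indep_of :: "nat \<Rightarrow> ((nat \<Rightarrow> nat) \<Rightarrow> 'b) \<Rightarrow> bool" where
  "indep_of k h \<longleftrightarrow> (\<forall>x b. h (x(k := b)) = h x)"

lemma avgs_Nil [simp]: "avgs p [] h = h"
  by (simp add: avgs_def)

lemma avgs_Cons [simp]: "avgs p (k # ks) h = avg p k (avgs p ks h)"
  by (simp add: avgs_def)

lemma avgs_append: "avgs p (ks @ ls) h = avgs p ks (avgs p ls h)"
  by (simp add: avgs_def)

lemma avgs_upt_Suc: "k \<le> N \<Longrightarrow> avgs p [k..<Suc N] h = avg p k (avgs p [Suc k..<Suc N] h)"
  by (simp add: upt_conv_Cons del: upt_Suc)

lemma indep_of_avg: "indep_of k (avg p k h)"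
  by (simp add: indep_of_def avg_def)

lemma indep_of_avg_other: "indep_of i h \<Longrightarrow> indep_of i (avg p k h)"
  by (cases "i = k") (auto simp: indep_of_def avg_def fun_upd_twist[of i k])

lemma indep_of_avgs: "i \<in> set ks \<Longrightarrow> indep_of i (avgs p ks h)"
proof (induction ks)
  case (Cons k ks)
  then show ?case
    by (cases "i = k") (simp_all add: indep_of_avg indep_of_avg_other)
qed simp

lemma avgs_linear: "avgs p ks (\<lambda>y. a * g y + b * h y) = (\<lambda>x. a * avgs p ks g x + b * avgs p ks h x)"
  by (induction ks) (auto simp: avg_def algebra_simps)

lemma avgs_const: "avgs p ks (\<lambda>y. a) = (\<lambda>x. a)"
  by (induction ks) (auto simp: avg_def algebra_simps)

lemma avgs_affine: "avgs p ks (\<lambda>y. a + b * h y) x = a + b * avgs p ks h x"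
  using avgs_linear[of p ks a "\<lambda>_. 1" b h] by (simp add: avgs_const)

lemma avgs_diff: "avgs p ks (\<lambda>y. g y - h y) x = avgs p ks g x - avgs p ks h x"
  using avgs_linear[of p ks 1 g "-1" h] by simp

lemma avgs_sum: "finite A \<Longrightarrow> avgs p ks (\<lambda>y. \<Sum>i\<in>A. a i * h i y) x = (\<Sum>i\<in>A. a i * avgs p ks (h i) x)"
proof (induction A rule: finite_induct)
  case (insert i A)
  then show ?case
    using avgs_linear[of p ks "a i" "h i" 1 "\<lambda>y. \<Sum>i\<in>A. a i * h i y"] by simp
qed (simp add: avgs_const)

text \<open>Taking out what is known: a factor blind to the averaged coordinates behaves like a
  constant.\<close>

lemma avgs_mult_left:
  assumes "\<And>k. k \<in> set ks \<Longrightarrow> indep_of k g"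
  shows "avgs p ks (\<lambda>y. g y * h y) = (\<lambda>x. g x * avgs p ks h x)"
  using assms by (induction ks) (auto simp: avg_def indep_of_def algebra_simps)

lemma avgs_indep:
  assumes "\<And>k. k \<in> set ks \<Longrightarrow> indep_of k g"
  shows "avgs p ks g = g"
  using avgs_mult_left[of ks g p "\<lambda>_. 1"] assms by (simp add: avgs_const)

text \<open>Turns the difference of two averages, taken at two values of coordinate
  \<open>i\<close>, into an average of differences.\<close>

lemma avgs_fun_upd:
  "i \<notin> set ks \<Longrightarrow> avgs p ks h (x(i := b)) = avgs p ks (\<lambda>y. h (y(i := b))) x"
proof (induction ks arbitrary: x)
  case (Cons k ks)
  then have "i \<noteq> k" and i: "i \<notin> set ks" by auto
  from \<open>i \<noteq> k\<close> have "x(i := b, k := v) = x(k := v, i := b)" for v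
    by (rule fun_upd_twist)
  then show ?case by (simp only: avgs_Cons avg_def Cons.IH[OF i])
qed simp

text \<open>Tower property: the inner average is already independent of \<open>ls\<close>, so
  averaging over \<open>ls\<close> again leaves it unchanged.\<close>

lemma avgs_tower: "avgs p (ks @ ls) (avgs p ls h) = avgs p (ks @ ls) h"
  by (simp add: avgs_append avgs_indep indep_of_avgs)

lemma fun_upd_in_cube: "x \<in> cube N \<Longrightarrow> k \<in> {1..N} \<Longrightarrow> b \<in> {0, 1} \<Longrightarrow> x(k := b) \<in> cube N"
  by (auto simp: cube_def PiE_iff extensional_def)

text \<open>Averaging only visits 0/1 updates of \<open>x\<close>; these stay in the cube, so
  comparing \<open>g\<close> and \<open>h\<close> there suffices.\<close>

lemma avgs_mono:
  assumes "\<And>y. y \<in> cube N \<Longrightarrow> g y \<le> h y"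
    and "set ks \<subseteq> {1..N}" and "\<And>k. k \<in> {1..N} \<Longrightarrow> 0 \<le> p k \<and> p k \<le> 1"
    and "x \<in> cube N"
  shows "avgs p ks g x \<le> avgs p ks h x"
  using assms(2,4)
proof (induction ks arbitrary: x)
  case (Cons k ks)
  then have "avgs p ks g (x(k := b)) \<le> avgs p ks h (x(k := b))" if "b \<in> {0,1}" for b
    using that fun_upd_in_cube[of x N k b] by auto
  moreover have "0 \<le> p k \<and> p k \<le> 1"
    using Cons.prems assms(3) by auto
  ultimately show ?case
    by (auto simp: avg_def intro!: add_mono mult_left_mono)
qed (use assms(1) in auto)

text \<open>Links the recursion to the product law; distinctness makes each coordinate contribute
  exactly one factor.\<close>

lemma avgs_eq_sum_PiE:
  assumes "distinct ks"
  shows "avgs p ks h x =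
    (\<Sum>y\<in>set ks \<rightarrow>\<^sub>E {0, 1}. (\<Prod>k\<in>set ks. if y k = 1 then p k else 1 - p k) * h (override_on x y (set ks)))"
  using assms
proof (induction ks arbitrary: x)
  case (Cons a ks)
  let ?S = "set ks" and ?w = "\<lambda>k b. if b = 1 then p k else 1 - p k"
  have a: "a \<notin> ?S" using Cons.prems by simp
  \<comment> \<open>An assignment on \<open>insert a ?S\<close> is its value at \<open>a\<close>
    together with its restriction to \<open>?S\<close>; the sum is reindexed accordingly.\<close>
  have ins: "(insert a ?S \<rightarrow>\<^sub>E {0, 1 :: nat}) = (\<lambda>(b, y). y(a := b)) ` ({0, 1} \<times> (?S \<rightarrow>\<^sub>E {0, 1}))"
    using PiE_insert_eq[of a ?S "\<lambda>_. {0, 1::nat}"] by simp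
  have inj: "inj_on (\<lambda>(b, y). y(a := b)) ({0, 1} \<times> (?S \<rightarrow>\<^sub>E {0, 1 :: nat}))"
    using inj_combinator[OF a, of "\<lambda>_. {0, 1::nat}"] by simp
  have ov: "override_on x (y(a := b)) (insert a ?S) = override_on (x(a := b)) y ?S" for y b
    using a by (auto simp: override_on_def fun_eq_iff)
  have pr: "(\<Prod>k\<in>insert a ?S. ?w k ((y(a := b)) k)) = ?w a b * (\<Prod>k\<in>?S. ?w k (y k))" for y :: "nat \<Rightarrow> nat" and b
  proof -
    have "(\<Prod>k\<in>?S. ?w k ((y(a := b)) k)) = (\<Prod>k\<in>?S. ?w k (y k))"
      using a by (intro prod.cong) auto
    then show ?thesis using a by simp
  qed
  have "(\<Sum>y\<in>insert a ?S \<rightarrow>\<^sub>E {0, 1}. (\<Prod>k\<in>insert a ?S. ?w k (y k)) * h (override_on x y (insert a ?S)))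
     = (\<Sum>(b, y)\<in>{0, 1} \<times> (?S \<rightarrow>\<^sub>E {0, 1}). ?w a b * (\<Prod>k\<in>?S. ?w k (y k)) * h (override_on (x(a := b)) y ?S))"
    unfolding ins sum.reindex[OF inj] by (intro sum.cong) (auto simp only: o_def case_prod_beta pr ov)
  also have "\<dots> = (\<Sum>b\<in>{0, 1}. ?w a b * avgs p ks h (x(a := b)))"
    using Cons by (simp add: sum.cartesian_product[symmetric] sum_distrib_left mult.assoc)
  also have "\<dots> = avgs p (a # ks) h x"
    by (simp add: avg_def)
  finally show ?case by simp
qed (simp add: override_on_def)

section \<open>Independent bits\<close>

lemma finite_cube: "finite (cube N)"
  by (simp add: cube_def finite_PiE)

lemma joint_in_cube: "independent_bits M N X p \<Longrightarrow> \<omega> \<in> space M \<Longrightarrow> joint N X \<omega> \<in> cube N"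
  by (auto simp: independent_bits_def joint_def cube_def)

lemma independent_bits_prob_bounds:
  assumes "independent_bits M N X p" and "k \<in> {1..N}"
  shows "0 \<le> p k \<and> p k \<le> 1"
proof -
  interpret prob_space M using assms by (simp add: independent_bits_def)
  show ?thesis using assms by (simp add: independent_bits_def)
qed

text \<open>Passage from the probability space to averages: independence gives each point of the
  cube its product weight. All coordinates get averaged, so \<open>x\<close> is just a base
  point.\<close>

lemma integral_joint:
  assumes ib: "independent_bits M N X p" and "N \<ge> 1" and x: "x \<in> cube N"
  shows "(\<integral>\<omega>. h (joint N X \<omega>) \<partial>M) = avgs p [1..<Suc N] h x"
proof -
  interpret prob_space M using ib by (simp add: independent_bits_def)
  have ind: "indep_vars (\<lambda>_. count_space UNIV) X {1..N}"
    and val: "\<And>k \<omega>. k \<in> {1..N} \<Longrightarrow> \<omega> \<in> space M \<Longrightarrow> X k \<omega> \<in> {0, 1}"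
    and p: "\<And>k. k \<in> {1..N} \<Longrightarrow> p k = \<P>(\<omega> in M. X k \<omega> = 1)"
    using ib by (auto simp: independent_bits_def)
  have meas: "X k \<in> measurable M (count_space UNIV)" if "k \<in> {1..N}" for k
    using ind that by (simp add: indep_vars_def)
  define A where "A y = {\<omega> \<in> space M. joint N X \<omega> = y}" for y
  \<comment> \<open>\<open>N \<ge> 1\<close> matters here: an empty intersection would be
    \<open>UNIV\<close> instead of \<open>space M\<close>.\<close>
  have A_eq: "A y = (\<Inter>k\<in>{1..N}. X k -` {y k} \<inter> space M)" if "y \<in> cube N" for y
    using that \<open>N \<ge> 1\<close>
    by (auto simp: A_def joint_def cube_def PiE_iff extensional_def restrict_def fun_eq_iff)
  have X_sets: "X k -` {b} \<inter> space M \<in> events" if "k \<in> {1..N}" for k b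
    using meas[OF that] by (rule measurable_sets) simp
  have A_sets: "A y \<in> events" if "y \<in> cube N" for y
    unfolding A_eq[OF that] using \<open>N \<ge> 1\<close> by (intro sets.finite_INT X_sets) auto
  have marg: "prob (X k -` {b} \<inter> space M) = (if b = 1 then p k else 1 - p k)"
    if k: "k \<in> {1..N}" and b: "b \<in> {0, 1}" for k b
  proof (cases "b = 1")
    case True
    then show ?thesis using p[OF k] by (simp add: vimage_def Int_def conj_commute)
  next
    case False
    with b val[OF k] have "X k -` {b} \<inter> space M = space M - (X k -` {1} \<inter> space M)"
      by fastforce
    then have "prob (X k -` {b} \<inter> space M) = 1 - prob (X k -` {1} \<inter> space M)"
      using X_sets[OF k] by (simp add: prob_compl)
    then show ?thesis using False p[OF k] by (simp add: vimage_def Int_def conj_commute)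
  qed
  have prob_A: "prob (A y) = (\<Prod>k\<in>{1..N}. if y k = 1 then p k else 1 - p k)" if y: "y \<in> cube N" for y
  proof -
    have "prob (A y) = (\<Prod>k\<in>{1..N}. prob (X k -` {y k} \<inter> space M))"
      unfolding A_eq[OF y] using \<open>N \<ge> 1\<close> by (intro indep_varsD_finite[OF ind]) auto
    also have "\<dots> = (\<Prod>k\<in>{1..N}. if y k = 1 then p k else 1 - p k)"
      using y by (intro prod.cong refl marg) (auto simp: cube_def)
    finally show ?thesis .
  qed
  have "(\<integral>\<omega>. h (joint N X \<omega>) \<partial>M) = (\<integral>\<omega>. (\<Sum>y\<in>cube N. h y * indicat_real (A y) \<omega>) \<partial>M)"
  proof (intro Bochner_Integration.integral_cong refl)
    fix \<omega> assume \<omega>: "\<omega> \<in> space M"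
    have "(\<Sum>y\<in>cube N. h y * indicat_real (A y) \<omega>) = (\<Sum>y\<in>cube N. if y = joint N X \<omega> then h y else 0)"
      using \<omega> by (intro sum.cong) (auto simp: A_def indicator_def)
    also have "\<dots> = h (joint N X \<omega>)"
      using joint_in_cube[OF ib \<omega>] by (simp add: finite_cube)
    finally show "h (joint N X \<omega>) = (\<Sum>y\<in>cube N. h y * indicat_real (A y) \<omega>)" by simp
  qed
  also have "\<dots> = (\<Sum>y\<in>cube N. h y * prob (A y))"
    using A_sets by (subst Bochner_Integration.integral_sum) (auto simp: emeasure_eq_measure)
  also have "\<dots> = (\<Sum>y\<in>cube N. (\<Prod>k\<in>{1..N}. if y k = 1 then p k else 1 - p k) * h (override_on x y {1..N}))"
  proof (intro sum.cong refl)
    fix y assume y: "y \<in> cube N"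
    have "override_on x y {1..N} = y"
      using x y by (auto simp: override_on_def cube_def PiE_iff extensional_def fun_eq_iff)
    then show "h y * prob (A y) = (\<Prod>k\<in>{1..N}. if y k = 1 then p k else 1 - p k) * h (override_on x y {1..N})"
      using prob_A[OF y] by simp
  qed
  also have "\<dots> = avgs p [1..<Suc N] h x"
    by (subst avgs_eq_sum_PiE) (simp_all add: cube_def atLeastLessThanSuc_atLeastAtMost del: upt_Suc)
  finally show ?thesis .
qed

lemma prob_joint:
  assumes ib: "independent_bits M N X p" and "N \<ge> 1" and "x \<in> cube N"
  shows "\<P>(\<omega> in M. P (joint N X \<omega>)) = avgs p [1..<Suc N] (\<lambda>y. of_bool (P y)) x"
proof -
  interpret prob_space M using ib by (simp add: independent_bits_def)
  have "(\<integral>\<omega>. of_bool (P (joint N X \<omega>)) \<partial>M) = (\<integral>\<omega>. indicat_real {\<omega> \<in> space M. P (joint N X \<omega>)} \<omega> \<partial>M)"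
    by (intro Bochner_Integration.integral_cong) auto
  also have "\<dots> = prob {\<omega> \<in> space M. P (joint N X \<omega>)}"
    by (subst Bochner_Integration.integral_indicator) (auto intro: arg_cong[where f = prob])
  finally show ?thesis
    using integral_joint[OF assms, of "\<lambda>y. of_bool (P y)"] by simp
qed

section \<open>Exponential moments\<close>

text \<open>The Taylor tail from order 2 on is dominated by a geometric series of ratio
  \<open>\<bar>x\<bar> / 3\<close>, as (n+2)! is at least 2 * 3^n. This is the source of the 3 in
  the Bernstein denominator.\<close>

lemma exp_le_quadratic:
  fixes x :: real
  assumes "\<bar>x\<bar> < 3"
  shows "exp x \<le> 1 + x + x\<^sup>2 / (2 * (1 - \<bar>x\<bar> / 3))"
proof -
  have fact_ge: "(2::real) * 3 ^ n \<le> fact (n + 2)" for n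
  proof (induction n)
    case (Suc n)
    have "(2::real) * 3 ^ Suc n \<le> 3 * fact (n + 2)" using Suc by (simp del: fact_Suc)
    also have "\<dots> \<le> (real n + 3) * fact (n + 2)" by (intro mult_right_mono) auto
    also have "\<dots> = fact (Suc n + 2)" by (simp add: algebra_simps)
    finally show ?case .
  qed (simp add: numeral_2_eq_2)
  have geo: "(\<lambda>n. (x\<^sup>2 / 2) * (\<bar>x\<bar> / 3) ^ n) sums ((x\<^sup>2 / 2) * (1 / (1 - \<bar>x\<bar> / 3)))"
    using assms by (intro sums_mult geometric_sums) auto
  have "(\<Sum>n. inverse (fact (n + 2)) *\<^sub>R x ^ (n + 2)) \<le> (\<Sum>n. (x\<^sup>2 / 2) * (\<bar>x\<bar> / 3) ^ n)"
  proof (rule suminf_le)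
    fix n
    have "inverse (fact (n + 2)) *\<^sub>R x ^ (n + 2) \<le> inverse (fact (n + 2)) * \<bar>x\<bar> ^ (n + 2)"
      by (simp del: power_Suc fact_Suc add_2_eq_Suc' add: power_abs[symmetric] mult_left_mono)
    also have "\<dots> \<le> inverse (2 * 3 ^ n) * \<bar>x\<bar> ^ (n + 2)"
      using fact_ge[of n] by (intro mult_right_mono le_imp_inverse_le) auto
    also have "\<dots> = (x\<^sup>2 / 2) * (\<bar>x\<bar> / 3) ^ n"
      by (simp add: power_add power_divide power2_eq_square field_simps)
    finally show "inverse (fact (n + 2)) *\<^sub>R x ^ (n + 2) \<le> (x\<^sup>2 / 2) * (\<bar>x\<bar> / 3) ^ n" .
  next
    show "summable (\<lambda>n. inverse (fact (n + 2)) *\<^sub>R x ^ (n + 2))"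
      by (rule summable_ignore_initial_segment[OF summable_exp_generic])
    show "summable (\<lambda>n. (x\<^sup>2 / 2) * (\<bar>x\<bar> / 3) ^ n)"
      using geo by (rule sums_summable)
  qed
  also have "\<dots> = x\<^sup>2 / (2 * (1 - \<bar>x\<bar> / 3))"
    using sums_unique[OF geo] by (simp add: field_simps)
  finally show ?thesis
    using exp_first_two_terms[of x] by simp
qed

text \<open>After centring, the scaled values are \<open>- (q * D)\<close> and
  \<open>(1 - q) * D\<close>: the linear terms cancel and the second moment is
  \<open>(1 - q) * q * D\<^sup>2\<close>.\<close>

lemma two_point_exp_moment:
  fixes q g0 g1 l m C :: real
  assumes q: "0 \<le> q" "q \<le> 1" and "\<bar>g1 - g0\<bar> \<le> m" and "m \<le> C" and l: "0 \<le> l" "l * C < 3"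
  shows "(1 - q) * exp (l * g0) + q * exp (l * g1)
    \<le> exp (l * ((1 - q) * g0 + q * g1) + (1 - q) * q * m\<^sup>2 * (l\<^sup>2 / (2 * (1 - l * C / 3))))"
proof -
  let ?K = "2 * (1 - l * C / 3)"
  define D where "D = l * (g1 - g0)"
  have K: "?K > 0" using l(2) by (simp add: mult.commute)
  have D: "\<bar>D\<bar> \<le> l * m" "l * m \<le> l * C"
    using assms by (auto simp: D_def abs_mult intro!: mult_left_mono)
  \<comment> \<open>Both centred values are at most \<open>l * C\<close> in size, so one denominator
    \<open>?K\<close> serves both.\<close>
  have bd: "exp x \<le> 1 + x + x\<^sup>2 / ?K" if "\<bar>x\<bar> \<le> \<bar>D\<bar>" for x
  proof -
    have "\<bar>x\<bar> \<le> l * C" using that D by linarith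
    then have "exp x \<le> 1 + x + x\<^sup>2 / (2 * (1 - \<bar>x\<bar> / 3))"
      using l(2) by (intro exp_le_quadratic) linarith
    also have "\<dots> \<le> 1 + x + x\<^sup>2 / ?K"
    proof -
      have "x\<^sup>2 / (2 * (1 - \<bar>x\<bar> / 3)) \<le> x\<^sup>2 / (2 * (1 - w / 3))" if "\<bar>x\<bar> \<le> w" "w < 3" for w
        using that by (intro divide_left_mono mult_pos_pos) auto
      then show ?thesis using l(2) \<open>\<bar>x\<bar> \<le> l * C\<close> by (intro add_left_mono)
    qed
    finally show ?thesis .
  qed
  have a0: "\<bar>- (q * D)\<bar> \<le> \<bar>D\<bar>" and a1: "\<bar>(1 - q) * D\<bar> \<le> \<bar>D\<bar>"
    using q by (auto simp: abs_mult intro!: mult_left_le_one_le)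
  let ?mu = "l * ((1 - q) * g0 + q * g1)"
  have "(1 - q) * exp (- (q * D)) + q * exp ((1 - q) * D)
      \<le> (1 - q) * (1 + - (q * D) + (- (q * D))\<^sup>2 / ?K) + q * (1 + (1 - q) * D + ((1 - q) * D)\<^sup>2 / ?K)"
    using q by (intro add_mono mult_left_mono bd a0 a1) auto
  also have "\<dots> = 1 + ((1 - q) * (- (q * D))\<^sup>2 + q * ((1 - q) * D)\<^sup>2) / ?K"
    unfolding add_divide_distrib by (simp only: distrib_left times_divide_eq_right) (simp add: algebra_simps)
  also have "(1 - q) * (- (q * D))\<^sup>2 + q * ((1 - q) * D)\<^sup>2 = (1 - q) * q * D\<^sup>2"
    by (simp add: power2_eq_square algebra_simps)
  also have "1 + (1 - q) * q * D\<^sup>2 / ?K \<le> 1 + (1 - q) * q * (l * m)\<^sup>2 / ?K"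
  proof -
    have "D\<^sup>2 \<le> (l * m)\<^sup>2" using D(1) by (simp add: abs_le_square_iff[symmetric])
    then show ?thesis using q K by (intro add_left_mono divide_right_mono mult_left_mono) auto
  qed
  also have "\<dots> \<le> exp ((1 - q) * q * (l * m)\<^sup>2 / ?K)"
    by (rule exp_ge_add_one_self)
  finally have main: "(1 - q) * exp (- (q * D)) + q * exp ((1 - q) * D) \<le> exp ((1 - q) * q * (l * m)\<^sup>2 / ?K)" .
  have "(1 - q) * exp (l * g0) + q * exp (l * g1)
      = exp ?mu * ((1 - q) * exp (- (q * D)) + q * exp ((1 - q) * D))"
  proof -
    have "l * g0 = ?mu + - (q * D)" "l * g1 = ?mu + (1 - q) * D"
      by (simp_all add: D_def algebra_simps)
    then have "exp (l * g0) = exp ?mu * exp (- (q * D))" "exp (l * g1) = exp ?mu * exp ((1 - q) * D)"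
      by (simp_all only: exp_add)
    then show ?thesis by (simp add: distrib_left)
  qed
  also have "\<dots> \<le> exp ?mu * exp ((1 - q) * q * (l * m)\<^sup>2 / ?K)"
    using main by (intro mult_left_mono) auto
  also have "\<dots> = exp (?mu + (1 - q) * q * m\<^sup>2 * (l\<^sup>2 / ?K))"
    by (simp add: exp_add power_mult_distrib mult_ac)
  finally show ?thesis .
qed

text \<open>The indicator does the work of stopping: \<open>good k\<close> is blind to the
  coordinates \<open>k..N\<close>, so it leaves the average over them, and the \<open>k\<close>-th
  increment needs control only where \<open>good k\<close> holds.\<close>

lemma exp_moment_on_good:
  assumes p: "\<And>k. k \<in> {1..N} \<Longrightarrow> 0 \<le> p k \<and> p k \<le> 1"
    and good: "\<And>i k. k \<in> {1..N} \<Longrightarrow> i \<in> {k..N} \<Longrightarrow> indep_of i (good k)"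
    and step: "\<And>k x. k \<in> {1..N} \<Longrightarrow> x \<in> cube N \<Longrightarrow> good k x \<Longrightarrow>
      \<bar>avgs p [Suc k..<Suc N] f (x(k := 1)) - avgs p [Suc k..<Suc N] f (x(k := 0))\<bar> \<le> m k"
    and mC: "\<And>k. k \<in> {1..N} \<Longrightarrow> m k \<le> C" and l: "0 \<le> l" "l * C < 3"
    and x: "x \<in> cube N"
  shows "avgs p [1..<Suc N] (\<lambda>y. exp (l * f y) * of_bool (\<forall>i\<in>{1..N}. good i y)) x
    \<le> exp (l * avgs p [1..<Suc N] f x
        + (\<Sum>k\<in>{1..N}. (1 - p k) * p k * (m k)\<^sup>2) * (l\<^sup>2 / (2 * (1 - l * C / 3))))"
proof -
  let ?s = "\<lambda>k. (1 - p k) * p k * (m k)\<^sup>2 * (l\<^sup>2 / (2 * (1 - l * C / 3)))"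
  let ?A = "\<lambda>k. avgs p [k..<Suc N]"
  let ?F = "\<lambda>k y. exp (l * f y) * of_bool (\<forall>i\<in>{k..N}. good i y)"
  have "1 \<le> Suc N" by simp
  then have "\<forall>x\<in>cube N. ?A 1 (?F 1) x \<le> exp (l * ?A 1 f x + (\<Sum>i\<in>{1..N}. ?s i))"
  \<comment> \<open>Downward from \<open>Suc N\<close>, where nothing is averaged and no constraint
    remains; each step adds the constraint \<open>good k\<close> and the variance term
    \<open>?s k\<close>.\<close>
  proof (induction rule: inc_induct)
    case base
    then show ?case by simp
  next
    case (step k)
    then have k: "k \<in> {1..N}" by auto
    have F: "?F k = (\<lambda>y. of_bool (good k y) * ?F (Suc k) y)"
    proof
      fix y
      have "{k..N} = insert k {Suc k..N}" using k by auto
      then show "?F k y = of_bool (good k y) * ?F (Suc k) y" by auto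
    qed
    have ind: "indep_of i (\<lambda>y. of_bool (good k y) :: real)" if "i \<in> {k..N}" for i
      using good[OF k that] by (simp add: indep_of_def)
    have "?A k (?F k) = (\<lambda>x. of_bool (good k x) * ?A k (?F (Suc k)) x)"
      unfolding F by (rule avgs_mult_left) (auto intro!: ind)
    moreover have "?A k (?F (Suc k)) x \<le> exp (l * ?A k f x + (\<Sum>i\<in>{k..N}. ?s i))"
      if x: "x \<in> cube N" and g: "good k x" for x
    proof -
      let ?S = "\<Sum>i\<in>{Suc k..N}. ?s i"
      let ?g = "\<lambda>b. ?A (Suc k) f (x(k := b))"
      have IH: "?A (Suc k) (?F (Suc k)) (x(k := b)) \<le> exp (l * ?g b + ?S)" if "b \<in> {0, 1}" for b
        using step.IH fun_upd_in_cube[OF x k that] by blast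
      have "?A k (?F (Suc k)) x = avg p k (?A (Suc k) (?F (Suc k))) x"
        using k by (subst avgs_upt_Suc) auto
      also have "\<dots> \<le> (1 - p k) * exp (l * ?g 0 + ?S) + p k * exp (l * ?g 1 + ?S)"
        unfolding avg_def using p[OF k] by (intro add_mono mult_left_mono IH) auto
      also have "\<dots> = exp ?S * ((1 - p k) * exp (l * ?g 0) + p k * exp (l * ?g 1))"
        by (simp add: exp_add algebra_simps)
      also have "\<dots> \<le> exp ?S * exp (l * ((1 - p k) * ?g 0 + p k * ?g 1) + ?s k)"
        using p[OF k] mC[OF k] l assms(3)[OF k x g]
        by (intro mult_left_mono two_point_exp_moment) auto
      also have "(1 - p k) * ?g 0 + p k * ?g 1 = ?A k f x"
        using k by (subst avgs_upt_Suc) (auto simp: avg_def)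
      also have "exp ?S * exp (l * ?A k f x + ?s k) = exp (l * ?A k f x + (\<Sum>i\<in>{k..N}. ?s i))"
      proof -
        have "(\<Sum>i\<in>{k..N}. ?s i) = ?s k + ?S"
          using k by (intro sum.atLeast_Suc_atMost) auto
        then show ?thesis by (simp only: exp_add[symmetric] add_ac)
      qed
      finally show ?thesis .
    qed
    \<comment> \<open>Where \<open>good k\<close> fails, the left side is 0.\<close>
    ultimately show ?case by (auto simp del: upt_Suc)
  qed
  with x show ?thesis by (simp only: sum_distrib_right)
qed

lemma bernstein_exponent:
  fixes V C t :: real
  assumes "0 \<le> V" "0 < C" "0 \<le> t"
  obtains l where "0 \<le> l" "l * C < 3"
    "- (l * t) + V * (l\<^sup>2 / (2 * (1 - l * C / 3))) \<le> - (t\<^sup>2 / (2 * V + 2 * C * t / 3))"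
proof (cases "V = 0")
  case True
  \<comment> \<open>For \<open>t > 0\<close> the choice \<open>t / W\<close> made below would give
    \<open>l * C = 3\<close>, the excluded endpoint. Half of it already attains the required
    exponent \<open>- 3 * t / (2 * C)\<close>; for \<open>t = 0\<close> the quotient 0/0 is
    0.\<close>
  show ?thesis
  proof (rule that[of "3 / (2 * C)"])
    show "- (3 / (2 * C) * t) + V * ((3 / (2 * C))\<^sup>2 / (2 * (1 - 3 / (2 * C) * C / 3))) \<le> - (t\<^sup>2 / (2 * V + 2 * C * t / 3))"
      using assms True by (cases "t = 0") (auto simp: power2_eq_square field_simps)
  qed (use assms in auto)
next
  case False
  \<comment> \<open>Half the target denominator. With \<open>l = t / W\<close>, the factor
    \<open>1 - l * C / 3\<close> equals \<open>V / W\<close> and the exponent collapses to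
    \<open>- (t\<^sup>2 / (2 * W))\<close>.\<close>
  define W where "W = V + C * t / 3"
  have V: "V > 0" and W: "W > 0" using False assms by (auto simp: W_def intro!: add_pos_nonneg)
  show ?thesis
  proof (rule that[of "t / W"])
    show "t / W * C < 3" using V W by (simp add: field_simps) (simp add: W_def)
    have "1 - t / W * C / 3 = V / W" using W unfolding W_def by (simp add: divide_simps)
    moreover have "V * ((t / W)\<^sup>2 / (2 * (V / W))) = t\<^sup>2 / (2 * W)"
      using V W by (simp add: power2_eq_square field_simps)
    moreover have "- (t / W * t) + t\<^sup>2 / (2 * W) = - (t\<^sup>2 / (2 * W))"
      using W by (simp add: power2_eq_square field_simps)
    moreover have "2 * W = 2 * V + 2 * C * t / 3" by (simp add: W_def)
    ultimately show "- (t / W * t) + V * ((t / W)\<^sup>2 / (2 * (1 - t / W * C / 3))) \<le> - (t\<^sup>2 / (2 * V + 2 * C * t / 3))"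
      by (simp only:)
  qed (use assms W in auto)
qed

section \<open>Typical bounded differences\<close>

text \<open>The Lipschitz hypothesis applies from either endpoint, so the bound holds with the
  indicator at either value of coordinate \<open>k\<close>. Weighting both bounds by
  \<open>1 - p k\<close> and \<open>p k\<close> gives an average over \<open>k..N\<close>, which no
  longer depends on coordinate \<open>k\<close>.\<close>

lemma typical_lipschitz_step:
  assumes p: "\<And>k. k \<in> {1..N} \<Longrightarrow> 0 \<le> p k \<and> p k \<le> 1"
    and tl: "typical_lipschitz N \<Gamma> f c d" and k: "k \<in> {1..N}" and cd: "c k \<le> d k"
    and x: "x \<in> cube N"
  shows "\<bar>avgs p [Suc k..<Suc N] f (x(k := 1)) - avgs p [Suc k..<Suc N] f (x(k := 0))\<bar>
    \<le> c k + avgs p [k..<Suc N] (\<lambda>y. of_bool (y \<notin> \<Gamma>)) x * (d k - c k)"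
proof -
  let ?A = "avgs p [Suc k..<Suc N]" and ?u = "\<lambda>y. of_bool (y \<notin> \<Gamma>) :: real"
  let ?D = "\<bar>?A f (x(k := 1)) - ?A f (x(k := 0))\<bar>"
  have ks: "k \<notin> set [Suc k..<Suc N]" "set [Suc k..<Suc N] \<subseteq> {1..N}" using k by auto
  have diff: "\<bar>f (y(k := 1)) - f (y(k := 0))\<bar> \<le> c k + (d k - c k) * ?u (y(k := b))"
    if y: "y \<in> cube N" and b: "b \<in> {0, 1}" for y b
  proof -
    have "differ_only_at N k (y(k := 1)) (y(k := 0))" "differ_only_at N k (y(k := 0)) (y(k := 1))"
      by (auto simp: differ_only_at_def)
    then have "\<bar>f (y(k := 1)) - f (y(k := 0))\<bar> \<le> (if y(k := 1) \<in> \<Gamma> then c k else d k)"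
      "\<bar>f (y(k := 0)) - f (y(k := 1))\<bar> \<le> (if y(k := 0) \<in> \<Gamma> then c k else d k)"
      using tl k fun_upd_in_cube[OF y k] by (auto simp only: typical_lipschitz_def insert_iff)
    then show ?thesis using b by (auto simp: abs_minus_commute)
  qed
  have bd: "?D \<le> c k + (d k - c k) * ?A ?u (x(k := b))" if b: "b \<in> {0, 1}" for b
  proof -
    have R: "c k + (d k - c k) * ?A ?u (x(k := b)) = ?A (\<lambda>y. c k + (d k - c k) * ?u (y(k := b))) x"
      by (simp add: avgs_affine avgs_fun_upd[OF ks(1)] del: upt_Suc)
    \<comment> \<open>Both orientations are recorded, since monotonicity of averages bounds the
      absolute value one side at a time.\<close>
    have "?A f (x(k := 1)) - ?A f (x(k := 0)) = ?A (\<lambda>y. f (y(k := 1)) - f (y(k := 0))) x"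
      "?A f (x(k := 0)) - ?A f (x(k := 1)) = ?A (\<lambda>y. f (y(k := 0)) - f (y(k := 1))) x"
      by (simp_all add: avgs_diff avgs_fun_upd[OF ks(1)] del: upt_Suc)
    moreover have "?A h x \<le> ?A (\<lambda>y. c k + (d k - c k) * ?u (y(k := b))) x"
      if "\<And>y. y \<in> cube N \<Longrightarrow> h y \<le> \<bar>f (y(k := 1)) - f (y(k := 0))\<bar>" for h
      using order_trans[OF that diff[OF _ b]] by (intro avgs_mono[OF _ ks(2) p x])
    ultimately show ?thesis unfolding R by (smt (verit))
  qed
  have "?D = (1 - p k) * ?D + p k * ?D" by (simp add: algebra_simps)
  also have "\<dots> \<le> (1 - p k) * (c k + (d k - c k) * ?A ?u (x(k := 0))) + p k * (c k + (d k - c k) * ?A ?u (x(k := 1)))"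
    using p[OF k] bd by (intro add_mono mult_left_mono) auto
  also have "\<dots> = c k + avg p k (?A ?u) x * (d k - c k)"
    by (simp add: avg_def algebra_simps)
  also have "avg p k (?A ?u) = avgs p [k..<Suc N] ?u"
    using k by (subst (2) avgs_upt_Suc) auto
  finally show ?thesis .
qed

section \<open>The bad event and its probability\<close>

text \<open>The law enters only through \<open>p\<close>, and neither \<open>f\<close> nor
  \<open>t\<close> occurs, so one event serves them all.\<close>

definition bad_event :: "nat \<Rightarrow> (nat \<Rightarrow> real) \<Rightarrow> (nat \<Rightarrow> real) \<Rightarrow> (nat \<Rightarrow> nat) set \<Rightarrow> (nat \<Rightarrow> nat) set" where
  "bad_event N p \<gamma> \<Gamma> = {x \<in> cube N. x \<notin> \<Gamma> \<or>
    (\<exists>k\<in>{1..N}. \<gamma> k < avgs p [k..<Suc N] (\<lambda>y. of_bool (y \<notin> \<Gamma>)) x)}"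

text \<open>Union bound and Markov's inequality: each \<open>?q k\<close> has mean \<open>P\<close>.
  There are \<open>N + 1\<close> ways to be bad but only \<open>N\<close> terms to pay for them, so
  \<open>k = 1\<close> needs separate care.\<close>

lemma prob_bad_event:
  assumes N: "N \<ge> 1" and \<gamma>: "\<And>k. k \<in> {1..N} \<Longrightarrow> 0 < \<gamma> k \<and> \<gamma> k \<le> 1"
    and ib: "independent_bits M N X p"
  shows "\<P>(\<omega> in M. joint N X \<omega> \<in> bad_event N p \<gamma> \<Gamma>)
    \<le> (\<Sum>k\<in>{1..N}. inverse (\<gamma> k) * \<P>(\<omega> in M. joint N X \<omega> \<notin> \<Gamma>))"
proof -
  interpret prob_space M using ib by (simp add: independent_bits_def)
  note p = independent_bits_prob_bounds[OF ib]
  define x0 where "x0 = (\<lambda>k\<in>{1..N}. 0::nat)"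
  have x0: "x0 \<in> cube N" by (auto simp: x0_def cube_def)
  let ?u = "\<lambda>y. of_bool (y \<notin> \<Gamma>) :: real"
  let ?q = "\<lambda>k. avgs p [k..<Suc N] ?u"
  define P where "P = \<P>(\<omega> in M. joint N X \<omega> \<notin> \<Gamma>)"
  have P: "P = ?q 1 x" if "x \<in> cube N" for x
    using prob_joint[OF ib N that, of "\<lambda>y. y \<notin> \<Gamma>"] by (simp only: P_def)
  have P0: "P \<ge> 0" by (simp add: P_def)
  have inv: "1 \<le> inverse (\<gamma> k)" if "k \<in> {1..N}" for k
    using \<gamma>[OF that] by (simp add: one_le_inverse)
  have split: "{1..N} = insert 1 {2..N}" using N by auto
  have rest: "0 \<le> (\<Sum>k\<in>{2..N}. inverse (\<gamma> k) * P)"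
    using \<gamma> P0 by (intro sum_nonneg mult_nonneg_nonneg) (auto simp: less_imp_le)
  \<comment> \<open>The average over all coordinates is constant: if it exceeds \<open>\<gamma> 1\<close> the bound is trivial, and
    otherwise the term \<open>k = 1\<close> is free to pay for the points outside \<open>\<Gamma>\<close>.\<close>
  show ?thesis
  proof (cases "\<gamma> 1 < P")
    case True
    have "prob {\<omega> \<in> space M. joint N X \<omega> \<in> bad_event N p \<gamma> \<Gamma>} \<le> 1" by (rule prob_le_1)
    also have "1 \<le> inverse (\<gamma> 1) * P"
      using True \<gamma>[of 1] N by (simp add: field_simps)
    finally show ?thesis using rest unfolding P_def[symmetric] split by simp
  next
    case False
    have q0: "0 \<le> ?q k y" if "y \<in> cube N" "k \<in> {1..N}" for k y
      using avgs_mono[where p = p and g = "\<lambda>_. 0" and h = ?u and ks = "[k..<Suc N]", OF _ _ p that(1)] that(2)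
      by (simp add: avgs_const subset_eq del: upt_Suc)
    \<comment> \<open>Pointwise form of the union bound with Markov; averaging it over all
      coordinates gives the estimate.\<close>
    have "of_bool (y \<in> bad_event N p \<gamma> \<Gamma>) \<le> ?u y + 1 * (\<Sum>k\<in>{2..N}. inverse (\<gamma> k) * ?q k y)"
      if y: "y \<in> cube N" for y
    proof -
      have nn: "0 \<le> inverse (\<gamma> k) * ?q k y" if "k \<in> {2..N}" for k
        using q0[OF y, of k] \<gamma>[of k] that by (intro mult_nonneg_nonneg) auto
      then have s0: "0 \<le> (\<Sum>k\<in>{2..N}. inverse (\<gamma> k) * ?q k y)" by (rule sum_nonneg)
      show ?thesis
      proof (cases "y \<in> bad_event N p \<gamma> \<Gamma> \<and> y \<in> \<Gamma>")
        case True
        then obtain k where k: "k \<in> {1..N}" "\<gamma> k < ?q k y" by (auto simp: bad_event_def simp del: upt_Suc)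
        with False P[OF y] have "k \<noteq> 1" by (auto simp del: upt_Suc)
        with k have k2: "k \<in> {2..N}" by auto
        have "1 \<le> inverse (\<gamma> k) * ?q k y"
          using k \<gamma>[of k] by (simp add: field_simps del: upt_Suc)
        also have "\<dots> \<le> (\<Sum>k\<in>{2..N}. inverse (\<gamma> k) * ?q k y)"
          using k2 nn by (intro member_le_sum) (auto simp del: upt_Suc)
        finally show ?thesis by (simp del: upt_Suc)
      next
        case False
        with s0 show ?thesis by (auto simp del: upt_Suc)
      qed
    qed
    then have "avgs p [1..<Suc N] (\<lambda>y. of_bool (y \<in> bad_event N p \<gamma> \<Gamma>)) x0
      \<le> avgs p [1..<Suc N] (\<lambda>y. 1 * ?u y + 1 * (\<Sum>k\<in>{2..N}. inverse (\<gamma> k) * ?q k y)) x0"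
      by (intro avgs_mono[OF _ _ p x0]) auto
    also have "\<dots> = ?q 1 x0 + (\<Sum>k\<in>{2..N}. inverse (\<gamma> k) * avgs p [1..<Suc N] (?q k) x0)"
      by (subst avgs_linear) (simp add: avgs_sum del: upt_Suc)
    also have "\<dots> = P + (\<Sum>k\<in>{2..N}. inverse (\<gamma> k) * P)"
    proof -
      have "avgs p [1..<Suc N] (?q k) x0 = P" if "k \<in> {2..N}" for k
      proof -
        have "[1..<Suc N] = [1..<k] @ [k..<Suc N]"
          using that upt_add_eq_append[of 1 k "Suc N - k"] by (simp del: upt_Suc)
        then show ?thesis
          using avgs_tower[of p "[1..<k]" "[k..<Suc N]" ?u] P[OF x0] by (simp only:)
      qed
      then show ?thesis using P[OF x0] by (simp del: upt_Suc)
    qed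
    also have "P + (\<Sum>k\<in>{2..N}. inverse (\<gamma> k) * P) \<le> (\<Sum>k\<in>{1..N}. inverse (\<gamma> k) * P)"
      using mult_right_mono[OF inv[of 1] P0] N unfolding split by simp
    finally show ?thesis
      unfolding P_def prob_joint[OF ib N x0, of "\<lambda>y. y \<in> bad_event N p \<gamma> \<Gamma>"] .
  qed
qed

section \<open>The tail bound off the bad event\<close>

text \<open>Chernoff's method with the exponential moment on the good points. The choice of
  \<open>l\<close> requires \<open>C > 0\<close>, so degenerate cases are split off first.\<close>

lemma typical_bounded_differences:
  assumes N: "N \<ge> 1" and \<Gamma>: "\<Gamma> \<subseteq> cube N"
    and \<gamma>: "\<And>k. k \<in> {1..N} \<Longrightarrow> 0 < \<gamma> k \<and> \<gamma> k \<le> 1"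
    and ib: "independent_bits M N X p"
    and cd: "\<And>k. k \<in> {1..N} \<Longrightarrow> c k \<le> d k" and tl: "typical_lipschitz N \<Gamma> f c d"
    and m: "m = (\<lambda>k. c k + \<gamma> k * (d k - c k))"
    and C: "C = Max (m ` {1..N})" and t: "0 \<le> t"
  shows "\<P>(\<omega> in M. f (joint N X \<omega>) \<ge> (\<integral>\<omega>. f (joint N X \<omega>) \<partial>M) + t \<and> joint N X \<omega> \<notin> bad_event N p \<gamma> \<Gamma>)
    \<le> exp (- (t\<^sup>2 / (2 * (\<Sum>k\<in>{1..N}. (1 - p k) * p k * (m k)\<^sup>2) + 2 * C * t / 3)))"
    (is "?L \<le> exp (- (t\<^sup>2 / (2 * ?V + _)))")
proof -
  interpret prob_space M using ib by (simp add: independent_bits_def)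
  note p = independent_bits_prob_bounds[OF ib]
  define x0 where "x0 = (\<lambda>k\<in>{1..N}. 0::nat)"
  have x0: "x0 \<in> cube N" by (auto simp: x0_def cube_def)
  let ?u = "\<lambda>y. of_bool (y \<notin> \<Gamma>) :: real"
  let ?E = "\<lambda>h. avgs p [1..<Suc N] h x0"
  define \<mu> where "\<mu> = ?E f"
  have \<mu>: "(\<integral>\<omega>. f (joint N X \<omega>) \<partial>M) = \<mu>"
    unfolding \<mu>_def by (rule integral_joint[OF ib N x0])
  have L: "?L = ?E (\<lambda>y. of_bool (f y \<ge> \<mu> + t \<and> y \<notin> bad_event N p \<gamma> \<Gamma>))"
    unfolding \<mu> by (rule prob_joint[OF ib N x0])
  have mC: "m k \<le> C" if "k \<in> {1..N}" for k using that by (auto simp: C)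
  have V: "0 \<le> ?V" using p by (intro sum_nonneg mult_nonneg_nonneg) auto
  show ?thesis
  \<comment> \<open>With \<open>\<Gamma>\<close> empty nothing forces \<open>c k\<close> to be
    nonnegative, but every point is bad. Otherwise flipping a coordinate of a point of
    \<open>\<Gamma>\<close> shows \<open>0 \<le> c k\<close>.\<close>
  proof (cases "\<Gamma> = {}")
    case True
    then have "bad_event N p \<gamma> \<Gamma> = cube N" by (auto simp: bad_event_def)
    then have "{\<omega> \<in> space M. f (joint N X \<omega>) \<ge> (\<integral>\<omega>. f (joint N X \<omega>) \<partial>M) + t \<and> joint N X \<omega> \<notin> bad_event N p \<gamma> \<Gamma>} = {}"
      using joint_in_cube[OF ib] by auto
    then show ?thesis by (simp only: measure_empty exp_ge_zero)
  next
    case False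
    then obtain z where z: "z \<in> \<Gamma>" by auto
    have m0: "0 \<le> m k" if k: "k \<in> {1..N}" for k
    proof -
      have zc: "z \<in> cube N" using z \<Gamma> by auto
      let ?y = "z(k := 1 - z k)"
      have "z k \<in> {0, 1}" using zc k by (auto simp: cube_def)
      then have "differ_only_at N k z ?y" "?y \<in> cube N"
        using fun_upd_in_cube[OF zc k, of "1 - z k"] by (auto simp: differ_only_at_def)
      then have "\<bar>f z - f ?y\<bar> \<le> c k"
        using tl z zc k by (force simp: typical_lipschitz_def)
      then show ?thesis using cd[OF k] \<gamma>[OF k] by (simp add: m)
    qed
    show ?thesis
    \<comment> \<open>Here all \<open>m k\<close> vanish; the exponent has denominator 0, hence
      value 0, and the bound is 1.\<close>
    proof (cases "C = 0")
      case True
      then have "?V = 0" using mC m0 by (intro sum.neutral) force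
      with True have "t\<^sup>2 / (2 * ?V + 2 * C * t / 3) = 0" by (simp only:) simp
      then show ?thesis by (simp only: minus_zero exp_zero prob_le_1)
    next
      case False
      have "0 < C" using mC[of 1] m0[of 1] N False by auto
      then obtain l where l: "0 \<le> l" "l * C < 3"
        and lb: "- (l * t) + ?V * (l\<^sup>2 / (2 * (1 - l * C / 3))) \<le> - (t\<^sup>2 / (2 * ?V + 2 * C * t / 3))"
        using bernstein_exponent[OF V _ t] by blast
      define good where "good k y \<longleftrightarrow> avgs p [k..<Suc N] ?u y \<le> \<gamma> k" for k y
      \<comment> \<open>Exponential Markov inequality: the new factor is at least 1 where
        \<open>f y \<ge> \<mu> + t\<close>, and points that are not bad satisfy every
        \<open>good i\<close>. The summand 0 fits the shape of \<open>avgs_affine\<close>.\<close>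
      have "?L \<le> ?E (\<lambda>y. 0 + exp (- (l * (\<mu> + t))) * (exp (l * f y) * of_bool (\<forall>i\<in>{1..N}. good i y)))"
        unfolding L
      proof (rule avgs_mono[OF _ _ p x0])
        fix y assume y: "y \<in> cube N"
        have "1 \<le> exp (- (l * (\<mu> + t))) * exp (l * f y)" if "\<mu> + t \<le> f y"
          using mult_left_mono[OF that l(1)] by (simp add: exp_add[symmetric])
        moreover have "\<forall>i\<in>{1..N}. good i y" if "y \<notin> bad_event N p \<gamma> \<Gamma>"
          using that y by (auto simp: bad_event_def good_def not_less simp del: upt_Suc)
        ultimately show "of_bool (f y \<ge> \<mu> + t \<and> y \<notin> bad_event N p \<gamma> \<Gamma>)
          \<le> 0 + exp (- (l * (\<mu> + t))) * (exp (l * f y) * of_bool (\<forall>i\<in>{1..N}. good i y))"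
          by auto
      qed auto
      also have "\<dots> = exp (- (l * (\<mu> + t))) * ?E (\<lambda>y. exp (l * f y) * of_bool (\<forall>i\<in>{1..N}. good i y))"
        by (subst avgs_affine) simp
      also have "\<dots> \<le> exp (- (l * (\<mu> + t))) * exp (l * ?E f + ?V * (l\<^sup>2 / (2 * (1 - l * C / 3))))"
      proof (intro mult_left_mono exp_moment_on_good p mC l x0)
        fix i k assume "k \<in> {1..N}" "i \<in> {k..N}"
        then have "indep_of i (avgs p [k..<Suc N] ?u)" by (intro indep_of_avgs) auto
        then show "indep_of i (good k)" by (simp add: indep_of_def good_def del: upt_Suc)
      next
        fix k x assume k: "k \<in> {1..N}" and x: "x \<in> cube N" and g: "good k x"
        have "avgs p [k..<Suc N] ?u x * (d k - c k) \<le> \<gamma> k * (d k - c k)"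
          using g cd[OF k] by (intro mult_right_mono) (auto simp: good_def simp del: upt_Suc)
        then show "\<bar>avgs p [Suc k..<Suc N] f (x(k := 1)) - avgs p [Suc k..<Suc N] f (x(k := 0))\<bar> \<le> m k"
          using typical_lipschitz_step[where p = p, OF p tl k cd[OF k] x] unfolding m by linarith
      qed auto
      also have "\<dots> = exp (- (l * t) + ?V * (l\<^sup>2 / (2 * (1 - l * C / 3))))"
        unfolding exp_add[symmetric] \<mu>_def[symmetric] by (simp add: algebra_simps)
      also have "\<dots> \<le> exp (- (t\<^sup>2 / (2 * ?V + 2 * C * t / 3)))"
        using lb by simp
      finally show ?thesis .
    qed
  qed
qed

text \<open>Choosing \<open>B\<close> before \<open>M\<close>, \<open>X\<close>, \<open>f\<close>,
  \<open>c\<close>, \<open>d\<close> and \<open>t\<close> expresses that it depends only on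
  \<open>\<Gamma>\<close>, \<open>\<gamma>\<close> and the law.\<close>

theorem theorem4:
  fixes N :: nat and p \<gamma> :: "nat \<Rightarrow> real" and \<Gamma> :: "(nat \<Rightarrow> nat) set"
  assumes "N \<ge> 1"
    and "\<Gamma> \<subseteq> cube N"
    and "\<forall>k\<in>{1..N}. 0 < \<gamma> k \<and> \<gamma> k \<le> 1"
  shows "\<exists>B. B \<subseteq> cube N \<and> cube N - B \<subseteq> \<Gamma> \<and>
    (\<forall>(M :: 'a measure) X. independent_bits M N X p \<longrightarrow>
      \<P>(\<omega> in M. joint N X \<omega> \<in> B)
        \<le> (\<Sum>k\<in>{1..N}. inverse (\<gamma> k) * \<P>(\<omega> in M. joint N X \<omega> \<notin> \<Gamma>)) \<and>
      (\<forall>(f :: (nat \<Rightarrow> nat) \<Rightarrow> real) c d.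
        (\<forall>k\<in>{1..N}. c k \<le> d k) \<longrightarrow> typical_lipschitz N \<Gamma> f c d \<longrightarrow>
        (let \<mu> = (\<integral>\<omega>. f (joint N X \<omega>) \<partial>M);
             e = (\<lambda>k. \<gamma> k * (d k - c k));
             C = Max ((\<lambda>k. c k + e k) ` {1..N})
         in \<forall>t\<ge>0.
           \<P>(\<omega> in M. f (joint N X \<omega>) \<ge> \<mu> + t \<and> joint N X \<omega> \<notin> B)
             \<le> exp (- (t\<^sup>2 / (2 * (\<Sum>k\<in>{1..N}. (1 - p k) * p k * (c k + e k)\<^sup>2)
                              + 2 * C * t / 3))))))"
proof (intro exI[of _ "bad_event N p \<gamma> \<Gamma>"] conjI allI impI)
  show "bad_event N p \<gamma> \<Gamma> \<subseteq> cube N" "cube N - bad_event N p \<gamma> \<Gamma> \<subseteq> \<Gamma>"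
    by (auto simp: bad_event_def)
next
  fix M :: "'a measure" and X
  assume "independent_bits M N X p"
  then show "\<P>(\<omega> in M. joint N X \<omega> \<in> bad_event N p \<gamma> \<Gamma>)
      \<le> (\<Sum>k\<in>{1..N}. inverse (\<gamma> k) * \<P>(\<omega> in M. joint N X \<omega> \<notin> \<Gamma>))"
    using assms by (intro prob_bad_event) auto
next
  fix M :: "'a measure" and X and f :: "(nat \<Rightarrow> nat) \<Rightarrow> real" and c d
  assume "independent_bits M N X p" "\<forall>k\<in>{1..N}. c k \<le> d k" "typical_lipschitz N \<Gamma> f c d"
  then show "let \<mu> = (\<integral>\<omega>. f (joint N X \<omega>) \<partial>M);
             e = (\<lambda>k. \<gamma> k * (d k - c k));
             C = Max ((\<lambda>k. c k + e k) ` {1..N})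
         in \<forall>t\<ge>0.
           \<P>(\<omega> in M. f (joint N X \<omega>) \<ge> \<mu> + t \<and> joint N X \<omega> \<notin> bad_event N p \<gamma> \<Gamma>)
             \<le> exp (- (t\<^sup>2 / (2 * (\<Sum>k\<in>{1..N}. (1 - p k) * p k * (c k + e k)\<^sup>2)
                              + 2 * C * t / 3)))"
    unfolding Let_def using assms
    by (intro allI impI typical_bounded_differences[OF _ _ _ _ _ _ refl refl]) auto
qed

end
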